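(* Let $r>s>0$ be integers and $\underline{x}=(x_2,\ldots,x_r)$ a tuple of elements of $\{0,1\}$. Every element of $\Gamma_{\underline{x}}$ is $\Phi$-finite.
   Context: Let $T$ be the infinite rooted regular binary tree whose vertices are the finite words over $\{0,1\}$, with root the empty word, each word $t$ being joined by an edge to the words $0t$ and $1t$. Let $W=\mathrm{Aut}(T)$ be the automorphism group of $T$ (products are compositions, $(uv)(t)=u(v(t))$), with identity element $1$. For $u,v\in W$, let $(u,v)\in W$ be the automorphism fixing the root and given by $t0\mapsto u(t)0$ and $t1\mapsto v(t)1$ for every word $t$. Let $\sigma\in W$ be the involution fixing the root with $t0\mapsto t1$ and $t1\mapsto t0$ for every word $t$. Then $W=(W\times W)\rtimes\langle\sigma\rangle$, so every $w\in W$ can be written uniquely as $(u,v)$ or as $(u,v)\,\sigma$. The first descendants of $w\in W$ are the elements $u$ and $v$ if $w=(u,v)$, respectively the single element $uv$ if $w=(u,v)\,\sigma$. For $n\ge1$, the first descendants of the $n$-th descendants of $w$ are the $(n+1)$-st descendants of $w$. $\mathrm{Desc}(w)$ is the set of all $n$-th descendants of $w$ for all $n\ge1$. An element $w$ is called $\Phi$-finite if $\mathrm{Desc}(w)$ is finite. Let $b_1,\ldots,b_r\in W$ be the elements determined by the recursion relations $b_1=\sigma$; $b_{s+1}=(b_r,b_s)$ if $x_{s+1}=0$; $b_{s+1}=(b_s,b_r)$ if $x_{s+1}=1$; $b_i=(b_{i-1},1)$ for all $i\ne1,s+1$ with $x_i=0$; $b_i=(1,b_{i-1})$ for all $i\neq1,s+1$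 with $x_i=1$. Let $\Gamma_{\underline{x}}\subset W$ be the subgroup generated by $b_1,\ldots,b_r$. *)

theory Defs
  imports "HOL-Algebra.Generated_Groups"
begin

text \<open>
  Letters: \<open>False\<close> stands for 0 and \<open>True\<close> for 1.  A word is the list of its letters, read from left
  to right; since children are obtained by adding a letter on the left, it is the last letter of a
  nonempty word that tells in which of the two subtrees below the root it lies.
\<close>

type_synonym vertex = "bool list"

definition adjacent :: "vertex \<Rightarrow> vertex \<Rightarrow> bool" where
  "adjacent t t' \<longleftrightarrow> (\<exists>a. t' = a # t \<or> t = a # t')"

definition tree_auts :: "(vertex \<Rightarrow> vertex) set" where
  "tree_auts = {w. bij w \<and> w [] = [] \<and> (\<forall>t t'. adjacent (w t) (w t') \<longleftrightarrow> adjacent t t')}"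

definition W :: "(vertex \<Rightarrow> vertex) monoid" where
  "W = \<lparr>carrier = tree_auts, mult = (\<circ>), one = id\<rparr>"

definition pair :: "(vertex \<Rightarrow> vertex) \<Rightarrow> (vertex \<Rightarrow> vertex) \<Rightarrow> vertex \<Rightarrow> vertex" where
  "pair u v t = (if t = [] then []
     else if last t then v (butlast t) @ [True] else u (butlast t) @ [False])"

definition swap_subtrees :: "vertex \<Rightarrow> vertex"  (\<open>\<sigma>\<close>) where
  "\<sigma> t = (if t = [] then [] else butlast t @ [\<not> last t])"

definition first_descendants :: "(vertex \<Rightarrow> vertex) \<Rightarrow> (vertex \<Rightarrow> vertex) set" where
  "first_descendants w =
     {d. \<exists>u\<in>carrier W. \<exists>v\<in>carrier W.
           (w = pair u v \<and> (d = u \<or> d = v)) \<or> (w = pair u v \<otimes>\<^bsub>W\<^esub> \<sigma> \<and> d = u \<otimes>\<^bsub>W\<^esub> v)}"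

text \<open>With the convention that \<open>w\<close> itself is the only 0-th descendant of \<open>w\<close>.\<close>

primrec nth_descendants :: "nat \<Rightarrow> (vertex \<Rightarrow> vertex) \<Rightarrow> (vertex \<Rightarrow> vertex) set" where
  "nth_descendants 0 w = {w}"
| "nth_descendants (Suc n) w = (\<Union>d\<in>nth_descendants n w. first_descendants d)"

definition Desc :: "(vertex \<Rightarrow> vertex) \<Rightarrow> (vertex \<Rightarrow> vertex) set" where
  "Desc w = (\<Union>n\<in>{1..}. nth_descendants n w)"

definition Phi_finite :: "(vertex \<Rightarrow> vertex) \<Rightarrow> bool" where
  "Phi_finite w \<longleftrightarrow> finite (Desc w)"

text \<open>Only the values of \<open>x\<close> on \<open>{2..r}\<close> and of \<open>b\<close> on \<open>{1..r}\<close> matter.\<close>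

definition recursion_relations ::
  "nat \<Rightarrow> nat \<Rightarrow> (nat \<Rightarrow> bool) \<Rightarrow> (nat \<Rightarrow> vertex \<Rightarrow> vertex) \<Rightarrow> bool" where
  "recursion_relations r s x b \<longleftrightarrow>
     b 1 = \<sigma> \<and>
     b (s + 1) = (if x (s + 1) then pair (b s) (b r) else pair (b r) (b s)) \<and>
     (\<forall>i\<in>{2..r} - {s + 1}.
        b i = (if x i then pair \<one>\<^bsub>W\<^esub> (b (i - 1)) else pair (b (i - 1)) \<one>\<^bsub>W\<^esub>))"

definition Gamma :: "nat \<Rightarrow> (nat \<Rightarrow> vertex \<Rightarrow> vertex) \<Rightarrow> (vertex \<Rightarrow> vertex) set" where
  "Gamma r b = generate W (b ` {1..r})"


subsection \<open>The notions above are well defined\<close>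

lemma adjacent_snoc [simp]: "adjacent (t @ [a]) (t' @ [a']) \<longleftrightarrow> a = a' \<and> adjacent t t'"
proof -
  have "t' @ [a'] = c # t @ [a] \<longleftrightarrow> a = a' \<and> t' = c # t"
       "t @ [a] = c # t' @ [a'] \<longleftrightarrow> a = a' \<and> t = c # t'" for c
    by (simp_all only: append_Cons[symmetric] append1_eq_conv) blast+
  then show ?thesis
    unfolding adjacent_def by auto
qed

lemma adjacent_Nil_snoc [simp]: "adjacent [] (t @ [a]) \<longleftrightarrow> t = []" "adjacent (t @ [a]) [] \<longleftrightarrow> t = []"
  by (auto simp: adjacent_def append_eq_Cons_conv)

lemma not_adjacent_Nil [simp]: "\<not> adjacent [] []"
  by (simp add: adjacent_def)

lemma pair_simps [simp]:
  "pair u v [] = []" "pair u v (t @ [False]) = u t @ [False]" "pair u v (t @ [True]) = v t @ [True]"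
  "pair u v [False] = u [] @ [False]" "pair u v [True] = v [] @ [True]"
  by (auto simp: pair_def)

lemma swap_simps [simp]: "\<sigma> [] = []" "\<sigma> (t @ [a]) = t @ [\<not> a]" "\<sigma> [a] = [\<not> a]"
  by (auto simp: swap_subtrees_def)

lemma snoc_cases3:
  fixes t :: vertex
  obtains "t = []" | t' where "t = t' @ [False]" | t' where "t = t' @ [True]"
  by (metis (full_types) rev_exhaust)

lemma carrier_W: "carrier W = tree_auts" and mult_W: "u \<otimes>\<^bsub>W\<^esub> v = u \<circ> v" and one_W: "\<one>\<^bsub>W\<^esub> = id"
  by (simp_all add: W_def)

lemma tree_autsI:
  assumes "\<And>t. w' (w t) = t" "\<And>t. w (w' t) = t" "w [] = []"
    "\<And>t t'. adjacent (w t) (w t') \<longleftrightarrow> adjacent t t'"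
  shows "w \<in> tree_auts"
proof -
  have "bij w"
    using assms(1,2) by (metis bijI')
  then show ?thesis
    using assms by (simp add: tree_auts_def)
qed

lemma tree_autsE:
  assumes "w \<in> tree_auts"
  obtains w' where "w [] = []" "\<And>t. w' (w t) = t" "\<And>t. w (w' t) = t"
    "\<And>t t'. adjacent (w t) (w t') \<longleftrightarrow> adjacent t t'"
proof -
  have w: "bij w" "w [] = []" "\<And>t t'. adjacent (w t) (w t') \<longleftrightarrow> adjacent t t'"
    using assms unfolding tree_auts_def by blast+
  show thesis
    by (rule that[of "inv_into UNIV w"])
      (use w(1,2) in \<open>simp_all add: bij_is_inj bij_is_surj surj_f_inv_f w(3)\<close>)
qed

lemma group_W: "group W"
proof (rule groupI)
  fix w assume "w \<in> carrier W"
  then obtain w' where w: "w [] = []" and inv: "\<And>t. w' (w t) = t" "\<And>t. w (w' t) = t"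
      and adj: "\<And>t t'. adjacent (w t) (w t') \<longleftrightarrow> adjacent t t'"
    unfolding carrier_W by (elim tree_autsE) blast
  have "w' [] = []" "adjacent (w' t) (w' t') \<longleftrightarrow> adjacent t t'" for t t'
    by (metis inv(1) w) (metis inv(2) adj)
  then have "w' \<in> carrier W"
    unfolding carrier_W by (intro tree_autsI[of w]) (simp_all add: inv)
  moreover have "w' \<circ> w = id"
    using inv by auto
  ultimately show "\<exists>w'\<in>carrier W. w' \<otimes>\<^bsub>W\<^esub> w = \<one>\<^bsub>W\<^esub>"
    by (auto simp: mult_W one_W)
qed (auto simp: W_def tree_auts_def bij_comp)

lemma swap_in_W: "\<sigma> \<in> carrier W"
proof -
  have inv: "\<sigma> (\<sigma> t) = t" for t by (cases t rule: rev_cases) auto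
  have "adjacent (\<sigma> t) (\<sigma> t') \<longleftrightarrow> adjacent t t'" for t t'
    by (cases t rule: rev_cases; cases t' rule: rev_cases) auto
  then show ?thesis
    unfolding carrier_W by (intro tree_autsI[of \<sigma>] inv) simp_all
qed

lemma pair_in_W:
  assumes "u \<in> carrier W" "v \<in> carrier W"
  shows "pair u v \<in> carrier W"
proof -
  obtain f where u: "u [] = []" "\<And>t. f (u t) = t" "\<And>t. u (f t) = t"
      "\<And>t t'. adjacent (u t) (u t') \<longleftrightarrow> adjacent t t'"
    by (rule tree_autsE[OF assms(1)[unfolded carrier_W]]) blast
  obtain g where v: "v [] = []" "\<And>t. g (v t) = t" "\<And>t. v (g t) = t"
      "\<And>t t'. adjacent (v t) (v t') \<longleftrightarrow> adjacent t t'"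
    by (rule tree_autsE[OF assms(2)[unfolded carrier_W]]) blast
  have *: "u t = [] \<longleftrightarrow> t = []" "v t = [] \<longleftrightarrow> t = []" for t
    by (metis u(1,2)) (metis v(1,2))
  have **: "f [] = []" "g [] = []"
    by (metis u(1,2)) (metis v(1,2))
  have "adjacent (pair u v t) (pair u v t') \<longleftrightarrow> adjacent t t'" for t t'
    by (cases t rule: snoc_cases3; cases t' rule: snoc_cases3) (simp_all add: u v *)
  moreover have "pair u v (pair f g t) = t" "pair f g (pair u v t) = t" for t
    by (cases t rule: snoc_cases3; simp add: u v * **)+
  ultimately show ?thesis
    unfolding carrier_W by (intro tree_autsI[of "pair f g"]) simp_all
qed

lemma pair_in_WD:
  assumes "pair u v \<in> carrier W"
  shows "u \<in> carrier W" "v \<in> carrier W"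
proof -
  let ?w = "pair u v"
  have w: "inj ?w" "surj ?w" "\<And>t t'. adjacent (?w t) (?w t') \<longleftrightarrow> adjacent t t'"
    using assms by (auto simp: carrier_W tree_auts_def bij_def)
  have "inj u" "inj v"
    by (intro injI, metis append1_eq_conv pair_simps w(1) injD)+
  moreover have "\<exists>t. y = u t" "\<exists>t. y = v t" for y
  proof -
    have "\<exists>t. y @ [False] = ?w t" "\<exists>t. y @ [True] = ?w t"
      using w(2) unfolding surj_def by blast+
    then obtain t t' where t: "y @ [False] = ?w t" and t': "y @ [True] = ?w t'" by blast
    show "\<exists>t. y = u t" using t by (cases t rule: snoc_cases3) auto
    show "\<exists>t. y = v t" using t' by (cases t' rule: snoc_cases3) auto
  qed
  moreover have "adjacent (u t) (u t') \<longleftrightarrow> adjacent t t'" "adjacent (v t) (v t') \<longleftrightarrow> adjacent t t'" for t t'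
    using w(3)[of "t @ [False]" "t' @ [False]"] w(3)[of "t @ [True]" "t' @ [True]"] by simp_all
  moreover have "adjacent [] [a]" for a by (simp add: adjacent_def)
  then have "u [] = []" "v [] = []"
    using w(3)[of "[]" "[False]"] w(3)[of "[]" "[True]"] by simp_all
  ultimately show "u \<in> carrier W" "v \<in> carrier W"
    by (auto simp: carrier_W tree_auts_def bij_def surj_def)
qed

lemma pair_eq_iff: "pair u v = pair u' v' \<longleftrightarrow> u = u' \<and> v = v'"
proof
  assume *: "pair u v = pair u' v'"
  have "u t = u' t" "v t = v' t" for t
    using fun_cong[OF *, of "t @ [False]"] fun_cong[OF *, of "t @ [True]"] by simp_all
  then show "u = u' \<and> v = v'" by auto
qed auto

lemma pair_swap_eq_iff: "pair u v \<otimes>\<^bsub>W\<^esub> \<sigma> = pair u' v' \<otimes>\<^bsub>W\<^esub> \<sigma> \<longleftrightarrow> u = u' \<and> v = v'"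
proof
  assume *: "pair u v \<otimes>\<^bsub>W\<^esub> \<sigma> = pair u' v' \<otimes>\<^bsub>W\<^esub> \<sigma>"
  have "u t = u' t" "v t = v' t" for t
    using fun_cong[OF *, of "t @ [False]"] fun_cong[OF *, of "t @ [True]"] by (simp_all add: mult_W)
  then show "u = u' \<and> v = v'" by auto
qed auto

lemma pair_neq_pair_swap: "pair u v \<noteq> pair u' v' \<otimes>\<^bsub>W\<^esub> \<sigma>"
proof
  assume *: "pair u v = pair u' v' \<otimes>\<^bsub>W\<^esub> \<sigma>"
  show False
    using fun_cong[OF *, of "[False]"] by (simp add: mult_W)
qed

lemma tree_aut_Cons:
  assumes "w \<in> carrier W"
  shows "\<exists>d. w (c # t) = d # w t"
proof (induction t arbitrary: c)
  case Nil
  have "adjacent [] [c]" by (simp add: adjacent_def)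
  then have "adjacent (w []) (w [c])" "w [] = []"
    using assms unfolding carrier_W tree_auts_def by blast+
  then show ?case by (auto simp: adjacent_def)
next
  case (Cons e t)
  have "adjacent (e # t) (c # e # t)" by (simp add: adjacent_def)
  then have inj: "inj w" and "adjacent (w (e # t)) (w (c # e # t))"
    using assms by (simp_all add: carrier_W tree_auts_def bij_is_inj)
  moreover obtain f where "w (e # t) = f # w t" using Cons.IH by blast
  moreover have "w (c # e # t) \<noteq> w t" using inj by (simp add: inj_eq)
  ultimately show ?case by (auto simp: adjacent_def)
qed

lemma tree_aut_snoc:
  assumes "w \<in> carrier W"
  shows "\<exists>p. \<forall>t. \<exists>y. w (t @ [a]) = y @ [p]"
proof -
  have "w [] = []" using assms by (simp add: carrier_W tree_auts_def)
  then obtain p where p: "w [a] = [p]" using tree_aut_Cons[OF assms, of a "[]"] by auto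
  have "\<exists>y. w (t @ [a]) = y @ [p]" for t
  proof (induction t)
    case Nil then show ?case using p by auto
  next
    case (Cons c t) then show ?case
      using tree_aut_Cons[OF assms, of c "t @ [a]"] by (metis append_Cons)
  qed
  then show ?thesis by blast
qed

lemma W_decomposition:
  assumes "w \<in> carrier W"
  shows "\<exists>u\<in>carrier W. \<exists>v\<in>carrier W. w = pair u v \<or> w = pair u v \<otimes>\<^bsub>W\<^esub> \<sigma>"
proof -
  interpret group W by (rule group_W)
  have *: "\<exists>u v. w = pair u v"
    if w: "w \<in> carrier W" "w (t @ [False]) = y @ [False]" for w t y
  proof -
    obtain p q where "\<forall>t. \<exists>y. w (t @ [False]) = y @ [p]" "\<forall>t. \<exists>y. w (t @ [True]) = y @ [q]"
      using tree_aut_snoc[OF w(1)] by meson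
    then obtain u v where uv: "\<And>t. w (t @ [False]) = u t @ [p]" "\<And>t. w (t @ [True]) = v t @ [q]"
      by metis
    have p: "\<not> p" using w(2) uv(1) by auto
    have "surj w" "w [] = []" using w(1) by (auto simp: carrier_W tree_auts_def bij_def)
    from this(1) obtain z where z: "w z = [] @ [True]" unfolding surj_def by metis
    have q: "q" using z uv p \<open>w [] = []\<close> by (cases z rule: snoc_cases3) auto
    have "w t = pair u v t" for t
      using uv p q \<open>w [] = []\<close> by (cases t rule: snoc_cases3) auto
    then show ?thesis by blast
  qed
  obtain p where p: "w [False] = [p]"
    using tree_aut_Cons[OF assms, of False "[]"] assms by (auto simp: carrier_W tree_auts_def)
  show ?thesis
  proof (cases p)
    case False
    then obtain u v where "w = pair u v" using *[OF assms, of "[]" "[]"] p by auto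
    then show ?thesis using assms pair_in_WD by blast
  next
    case True
    obtain q where q': "w [True] = [q]"
      using tree_aut_Cons[OF assms, of True "[]"] assms by (auto simp: carrier_W tree_auts_def)
    have "inj w" using assms by (simp add: carrier_W tree_auts_def bij_def)
    then have "w [True] \<noteq> w [False]" by (simp add: inj_eq)
    then have q: "\<not> q" using p q' True by simp
    have ws: "w \<otimes>\<^bsub>W\<^esub> \<sigma> \<in> carrier W" using assms swap_in_W by simp
    have "(w \<otimes>\<^bsub>W\<^esub> \<sigma>) ([] @ [False]) = [] @ [False]"
      using q' q by (simp add: mult_W)
    then obtain u v where uv: "w \<otimes>\<^bsub>W\<^esub> \<sigma> = pair u v" using *[OF ws] by blast
    have "\<sigma> (\<sigma> t) = t" for t by (cases t rule: rev_cases) auto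
    then have "w = pair u v \<otimes>\<^bsub>W\<^esub> \<sigma>"
      unfolding uv[symmetric] by (auto simp: mult_W)
    then show ?thesis using ws pair_in_WD unfolding uv by blast
  qed
qed

lemma first_descendants_pair:
  "\<lbrakk>u \<in> carrier W; v \<in> carrier W\<rbrakk> \<Longrightarrow> first_descendants (pair u v) = {u, v}"
  unfolding first_descendants_def by (auto simp: pair_eq_iff pair_neq_pair_swap)

lemma first_descendants_pair_swap:
  "\<lbrakk>u \<in> carrier W; v \<in> carrier W\<rbrakk> \<Longrightarrow> first_descendants (pair u v \<otimes>\<^bsub>W\<^esub> \<sigma>) = {u \<otimes>\<^bsub>W\<^esub> v}"
  unfolding first_descendants_def by (auto simp: pair_swap_eq_iff pair_neq_pair_swap[symmetric])

text \<open>
  The recursion relations have exactly one solution.  For existence, \<open>run\<close> evaluates the \<open>b i\<close> on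
  reversed words; the index 0 stands for the identity.
\<close>

primrec run :: "(nat \<Rightarrow> bool \<Rightarrow> nat) \<Rightarrow> nat \<Rightarrow> vertex \<Rightarrow> vertex" where
  "run N i [] = []"
| "run N i (a # t) = (if i = 1 then (\<not> a) # t else a # run N (N i a) t)"

lemma run_eq_Nil: "run N i t = [] \<longleftrightarrow> t = []" "[] = run N i t \<longleftrightarrow> t = []"
  by (cases t; simp)+

lemma run_run: "run N i (run N i t) = t"
  by (induction t arbitrary: i) auto

lemma run_adjacent:
  "adjacent (rev (run N i t)) (rev (run N i t')) \<longleftrightarrow> adjacent (rev t) (rev t')"
proof (induction t arbitrary: t' i)
  case Nil show ?case by (cases t') (auto simp: run_eq_Nil)
next
  case (Cons a t) then show ?case by (cases t') (auto simp: run_eq_Nil)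
qed

lemma recursion_relations_exist:
  assumes "r > s" "s > 0"
  shows "\<exists>b. (\<forall>i\<in>{1..r}. b i \<in> carrier W) \<and> recursion_relations r s x b"
proof -
  define N where "N i a = (if i = s + 1 then if a = x i then r else s
    else if a = x i then i - 1 else 0)" for i a
  define b where "b i t = rev (run N i (rev t))" for i t
  have "b i (b i t) = t" for i t by (simp add: b_def run_run)
  moreover have "adjacent (b i t) (b i t') \<longleftrightarrow> adjacent t t'" for i t t'
    using run_adjacent[of N i "rev t" "rev t'"] by (simp add: b_def)
  ultimately have "b i \<in> carrier W" for i
    unfolding carrier_W by (intro tree_autsI[of "b i"]) (simp_all add: b_def)
  moreover have "run N 0 t = t" for t by (induction t) (simp_all add: N_def)
  then have b0: "b 0 t = t" for t by (simp add: b_def)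
  have b1: "b 1 = \<sigma>"
  proof
    show "b 1 t = \<sigma> t" for t by (cases t rule: rev_cases) (auto simp: b_def)
  qed
  have b: "b i = pair (b (N i False)) (b (N i True))" if "i \<noteq> 1" for i
  proof
    show "b i t = pair (b (N i False)) (b (N i True)) t" for t
      using that by (cases t rule: snoc_cases3) (auto simp: b_def)
  qed
  have "b (s + 1) = (if x (s + 1) then pair (b s) (b r) else pair (b r) (b s))"
    using b[of "s + 1"] assms by (simp add: N_def)
  moreover have "b i = (if x i then pair \<one>\<^bsub>W\<^esub> (b (i - 1)) else pair (b (i - 1)) \<one>\<^bsub>W\<^esub>)"
    if "i \<in> {2..r} - {s + 1}" for i
  proof -
    have "b 0 = \<one>\<^bsub>W\<^esub>" using b0 by (auto simp: one_W)
    then show ?thesis using b[of i] that by (auto simp: N_def)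
  qed
  ultimately show ?thesis
    unfolding recursion_relations_def using b1 by blast
qed

lemma recursion_relations_unique:
  assumes "r > s" "s > 0" "recursion_relations r s x b" "recursion_relations r s x b'"
    and "i \<in> {1..r}"
  shows "b i = b' i"
proof
  show "b i t = b' i t" for t
    using \<open>i \<in> {1..r}\<close>
  proof (induction t arbitrary: i rule: rev_induct)
    case Nil
    have "f i [] = []" if "recursion_relations r s x f" for f
      using that Nil unfolding recursion_relations_def
      by (cases "i = 1"; cases "i = s + 1"; cases "x i") (auto simp: one_W)
    from this[OF assms(3)] this[OF assms(4)] show ?case by simp
  next
    case (snoc a t)
    consider "i = 1" | "i = s + 1" | "i \<in> {2..r} - {s + 1}" using snoc.prems by force
    then show ?case
    proof cases
      case 1
      then show ?thesis using assms by (simp add: recursion_relations_def)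
    next
      case 2
      then have "f i = (if x i then pair (f s) (f r) else pair (f r) (f s))"
        if "recursion_relations r s x f" for f
        using that by (simp add: recursion_relations_def)
      moreover have "b s t = b' s t" "b r t = b' r t" using snoc.IH assms by simp_all
      ultimately show ?thesis using assms by (cases a) auto
    next
      case 3
      then have "f i = (if x i then pair \<one>\<^bsub>W\<^esub> (f (i - 1)) else pair (f (i - 1)) \<one>\<^bsub>W\<^esub>)"
        if "recursion_relations r s x f" for f
        using that unfolding recursion_relations_def by blast
      moreover have "b (i - 1) t = b' (i - 1) t" using 3 by (intro snoc.IH) auto
      ultimately show ?thesis using assms by (cases a) auto
    qed
  qed
qed

end

theory Submission
  imports Defs "HOL-Library.Multiset"
begin

text \<open>
  The generators are involutions, so \<open>w\<close> is a word in them.  Passing to a first descendant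
  removes every letter \<open>b\<^sub>1\<close>, replaces a letter \<open>b\<^sub>i\<close> by at most one letter \<open>b\<^bsub>i-1\<^esub>\<close>, and a letter
  \<open>b\<^bsub>s+1\<^esub>\<close> by at most one \<open>b\<^sub>s\<close> and one \<open>b\<^sub>r\<close>.  So the number of letters with index above \<open>s\<close>
  never grows, and for \<open>j \<le> s\<close> the number of letters \<open>b\<^sub>j\<close> is at most the previous number of
  letters \<open>b\<^bsub>j+1\<^esub>\<close>.  Hence, if \<open>M\<close> bounds all these numbers for \<open>w\<close>, it bounds them for all
  descendants, which are therefore values of words of bounded length.
\<close>

section \<open>Words with bounded letter counts\<close>

definition word :: "(nat \<Rightarrow> vertex \<Rightarrow> vertex) \<Rightarrow> nat list \<Rightarrow> vertex \<Rightarrow> vertex" where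
  "word b ps = foldr (\<lambda>i u. b i \<circ> u) ps id"

lemma word_simps [simp]: "word b [] = id" "word b (i # ps) = b i \<circ> word b ps"
  by (simp_all add: word_def)

lemma word_append: "word b (ps @ qs) = word b ps \<circ> word b qs"
  by (induction ps) (simp_all add: o_assoc)

text \<open>The indices \<open>s + 1, ..., r\<close> are counted together: \<open>b (s + 1)\<close>
  gives back \<open>b r\<close>, so descent moves letters around this cycle without raising their
  total.\<close>

definition bounded_words :: "nat \<Rightarrow> nat \<Rightarrow> nat \<Rightarrow> nat list set" where
  "bounded_words r s M =
     {ps. set ps \<subseteq> {1..r} \<and> (\<forall>j\<in>{1..s}. count_list ps j \<le> M) \<and> length (filter ((<) s) ps) \<le> M}"

lemma count_list_le_length_filter: "P j \<Longrightarrow> count_list ps j \<le> length (filter P ps)"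
  by (induction ps) auto

text \<open>Each of the \<open>r\<close> possible letters occurs at most \<open>M\<close> times,
  those above \<open>s\<close> by the joint bound, so the length is at most
  \<open>r * M\<close>.\<close>

lemma finite_bounded_words: "finite (bounded_words r s M)"
proof (rule finite_subset)
  show "bounded_words r s M \<subseteq> {ps. set ps \<subseteq> {1..r} \<and> length ps \<le> r * M}"
  proof
    fix ps assume *: "ps \<in> bounded_words r s M"
    have "count_list ps j \<le> M" if "j \<in> {1..r}" for j
    proof (cases "j \<le> s")
      case True
      then show ?thesis using * that by (simp add: bounded_words_def)
    next
      case False
      then have "count_list ps j \<le> length (filter ((<) s) ps)"
        by (intro count_list_le_length_filter) simp
      also have "\<dots> \<le> M" using * by (simp add: bounded_words_def)
      finally show ?thesis .
    qed
    then have "sum (count_list ps) {1..r} \<le> r * M"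
      using sum_bounded_above[of "{1..r}" "count_list ps" M] by simp
    moreover have "sum (count_list ps) {1..r} = length ps"
      using * by (intro sum_count_set) (auto simp: bounded_words_def)
    ultimately show "ps \<in> {ps. set ps \<subseteq> {1..r} \<and> length ps \<le> r * M}"
      using * by (simp add: bounded_words_def)
  qed
qed (simp add: finite_lists_length_le)

section \<open>Multiplication rules for pairs and the swap\<close>

lemma pair_comp_pair: "pair u v \<circ> pair u' v' = pair (u \<circ> u') (v \<circ> v')"
proof
  show "(pair u v \<circ> pair u' v') t = pair (u \<circ> u') (v \<circ> v') t" for t
    by (cases t rule: snoc_cases3) auto
qed

lemma swap_comp_pair: "\<sigma> \<circ> pair u v = pair v u \<circ> \<sigma>"
proof
  show "(\<sigma> \<circ> pair u v) t = (pair v u \<circ> \<sigma>) t" for t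
    by (cases t rule: snoc_cases3) auto
qed

lemma swap_comp_swap: "\<sigma> \<circ> \<sigma> = id"
proof
  show "(\<sigma> \<circ> \<sigma>) t = id t" for t
    by (cases t rule: rev_cases) auto
qed

lemma pair_id_id: "pair id id = id"
proof
  show "pair id id t = id t" for t
    by (cases t rule: snoc_cases3) auto
qed

section \<open>The generators and the words in them\<close>

locale recursive_generators =
  fixes r s :: nat and x :: "nat \<Rightarrow> bool" and b :: "nat \<Rightarrow> vertex \<Rightarrow> vertex"
  assumes s_less_r: "s < r" and s_pos: "0 < s"
    and b_in_W: "i \<in> {1..r} \<Longrightarrow> b i \<in> carrier W"
    and rec: "recursion_relations r s x b"
begin

lemma b_one: "b 1 = \<sigma>"
  using rec by (simp add: recursion_relations_def)

text \<open>Coding the identity as the empty word makes all recursion relations alike. The multiset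
  forgets which component holds which letter, so the values of \<open>x\<close> drop out.\<close>

lemma b_eq_pair:
  assumes "i \<in> {2..r}"
  obtains ps qs where "b i = pair (word b ps) (word b qs)"
    "ps = [] \<or> (\<exists>k\<in>{1..r}. ps = [k])" "qs = [] \<or> (\<exists>k\<in>{1..r}. qs = [k])"
    "mset ps + mset qs = (if i = s + 1 then {#s, r#} else {#i - 1#})"
proof (cases "i = s + 1")
  case True
  then have "b i = (if x i then pair (word b [s]) (word b [r]) else pair (word b [r]) (word b [s]))"
    using rec by (simp add: recursion_relations_def)
  then show ?thesis
    using that[of "[s]" "[r]"] that[of "[r]" "[s]"] True s_less_r s_pos
    by (cases "x i") (auto simp: add_mset_commute)
next
  case False
  then have "b i = (if x i then pair (word b []) (word b [i - 1])
    else pair (word b [i - 1]) (word b []))"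
    using rec assms by (simp add: recursion_relations_def one_W)
  moreover have "i - 1 \<in> {1..r}" using assms by auto
  ultimately show ?thesis
    using that[of "[]" "[i - 1]"] that[of "[i - 1]" "[]"] False
    by (cases "x i") auto
qed

text \<open>For \<open>i\<close> other than 1, \<open>b i\<close> acts on \<open>t @ [a]\<close>
  through a generator or the identity on \<open>t\<close>; hence induction on the vertex, for all
  \<open>i\<close> at once.\<close>

lemma b_involution:
  assumes "i \<in> {1..r}"
  shows "b i \<circ> b i = id"
proof
  show "(b i \<circ> b i) t = id t" for t
    using assms
  proof (induction t arbitrary: i rule: rev_induct)
    case Nil
    then show ?case using b_in_W by (simp add: carrier_W tree_auts_def)
  next
    case (snoc a t)
    show ?case
    proof (cases "i = 1")
      case True
      then show ?thesis using b_one by simp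
    next
      case False
      then have "i \<in> {2..r}" using snoc.prems by auto
      then obtain ps qs where *: "b i = pair (word b ps) (word b qs)"
        "ps = [] \<or> (\<exists>k\<in>{1..r}. ps = [k])" "qs = [] \<or> (\<exists>k\<in>{1..r}. qs = [k])"
        by (rule b_eq_pair)
      from *(2) have "word b ps (word b ps t) = t" using snoc.IH by auto
      moreover from *(3) have "word b qs (word b qs t) = t" using snoc.IH by auto
      ultimately show ?thesis using *(1) by (cases a) simp_all
    qed
  qed
qed

lemma word_in_W: "set ps \<subseteq> {1..r} \<Longrightarrow> word b ps \<in> carrier W"
proof (induction ps)
  case Nil
  show "word b [] \<in> carrier W"
    using group.is_monoid[OF group_W, THEN monoid.one_closed] by (simp add: one_W)
next
  case (Cons i ps)
  then show "word b (i # ps) \<in> carrier W"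
    using group.is_monoid[OF group_W, THEN monoid.m_closed, of "b i" "word b ps"] b_in_W[of i]
    by (simp add: mult_W)
qed

lemma Gamma_subset_words: "w \<in> Gamma r b \<Longrightarrow> \<exists>ps. set ps \<subseteq> {1..r} \<and> w = word b ps"
  unfolding Gamma_def
proof (induction rule: generate.induct)
  case one
  then show ?case by (intro exI[of _ "[]"]) (simp add: one_W)
next
  case (incl h)
  then obtain i where "i \<in> {1..r}" "h = b i" by blast
  then show ?case by (intro exI[of _ "[i]"]) simp
next
  case (inv h)
  then obtain i where i: "i \<in> {1..r}" "h = b i" by blast
  have "inv\<^bsub>W\<^esub> h = h"
    using b_involution[OF i(1)] b_in_W[OF i(1)] i(2)
    by (intro group.inv_equality[OF group_W]) (simp_all add: mult_W one_W)
  with i show ?case by (intro exI[of _ "[i]"]) simp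
next
  case (eng g h)
  then obtain ps qs where "set ps \<subseteq> {1..r}" "g = word b ps" "set qs \<subseteq> {1..r}" "h = word b qs"
    by blast
  then show ?case by (intro exI[of _ "ps @ qs"]) (simp add: mult_W word_append)
qed

section \<open>Descendants of words\<close>

text \<open>The bounds concern \<open>ps @ qs\<close> because it spells the descendant when \<sigma>
  is present; without \<sigma> they pass to \<open>ps\<close> and \<open>qs\<close> separately.
  Induction adds one letter on the left.\<close>

lemma word_decomposition:
  assumes "set ks \<subseteq> {1..r}"
  shows "\<exists>ps qs. (word b ks = pair (word b ps) (word b qs)
             \<or> word b ks = pair (word b ps) (word b qs) \<otimes>\<^bsub>W\<^esub> \<sigma>)
           \<and> set (ps @ qs) \<subseteq> {1..r}
           \<and> (\<forall>j\<in>{1..s}. count_list (ps @ qs) j \<le> count_list ks (Suc j))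
           \<and> length (filter ((<) s) (ps @ qs)) \<le> length (filter ((<) s) ks)"
  using assms
proof (induction ks)
  case Nil
  have "word b [] = pair (word b []) (word b [])"
    by (simp add: pair_id_id)
  then show ?case by fastforce
next
  case (Cons k ks)
  then obtain ps qs where
    split: "word b ks = pair (word b ps) (word b qs)
      \<or> word b ks = pair (word b ps) (word b qs) \<circ> \<sigma>" and
    ij: "set (ps @ qs) \<subseteq> {1..r}"
      "\<forall>j\<in>{1..s}. count_list (ps @ qs) j \<le> count_list ks (Suc j)"
      "length (filter ((<) s) (ps @ qs)) \<le> length (filter ((<) s) ks)"
    unfolding mult_W by (metis (no_types, lifting) insert_subset list.simps(15))
  show ?case
  proof (cases "k = 1")
    case True
    \<comment> \<open>Moving the new \<sigma> to the right exchanges the components and toggles the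
      trailing \<sigma>; no letter is added.\<close>
    from split have "word b (k # ks) = pair (word b qs) (word b ps)
      \<or> word b (k # ks) = pair (word b qs) (word b ps) \<otimes>\<^bsub>W\<^esub> \<sigma>"
      unfolding True word_simps b_one mult_W
      by (metis comp_id o_assoc swap_comp_pair swap_comp_swap)
    moreover have "set (qs @ ps) \<subseteq> {1..r}"
      "\<forall>j\<in>{1..s}. count_list (qs @ ps) j \<le> count_list (k # ks) (Suc j)"
      "length (filter ((<) s) (qs @ ps)) \<le> length (filter ((<) s) (k # ks))"
      using ij True s_pos by (auto simp: add.commute)
    ultimately show ?thesis by blast
  next
    case False
    then have k: "k \<in> {2..r}" using Cons.prems by auto
    obtain ps' qs' where *: "b k = pair (word b ps') (word b qs')"
      "ps' = [] \<or> (\<exists>k\<in>{1..r}. ps' = [k])" "qs' = [] \<or> (\<exists>k\<in>{1..r}. qs' = [k])"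
      "mset ps' + mset qs' = (if k = s + 1 then {#s, r#} else {#k - 1#})"
      using b_eq_pair[OF k] by blast
    from split have "word b (k # ks) = pair (word b (ps' @ ps)) (word b (qs' @ qs))
      \<or> word b (k # ks) = pair (word b (ps' @ ps)) (word b (qs' @ qs)) \<otimes>\<^bsub>W\<^esub> \<sigma>"
      unfolding word_append word_simps *(1) mult_W pair_comp_pair[symmetric]
      by (metis o_assoc)
    moreover have "set ((ps' @ ps) @ (qs' @ qs)) \<subseteq> {1..r}"
      using ij(1) *(2,3) by auto
    \<comment> \<open>As \<open>j \<le> s < r\<close>, the letter \<open>r\<close> coming from
      \<open>b (s + 1)\<close> is not counted here.\<close>
    moreover have "count_list (ps' @ qs') j \<le> (if k = Suc j then 1 else 0)" if "j \<in> {1..s}" for j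
    proof -
      have "count_list (ps' @ qs') j = count (mset ps' + mset qs') j"
        by (simp add: count_mset)
      then show ?thesis using *(4) s_less_r k that by (auto split: if_splits)
    qed
    then have "\<forall>j\<in>{1..s}. count_list ((ps' @ ps) @ (qs' @ qs)) j \<le> count_list (k # ks) (Suc j)"
      using ij(2) by (fastforce split: if_splits)
    \<comment> \<open>If \<open>k = s + 1\<close>, only \<open>r\<close> lies above
      \<open>s\<close>; otherwise \<open>k - 1\<close> does so only for
      \<open>k > s + 1\<close>.\<close>
    moreover have "length (filter ((<) s) (ps' @ qs')) \<le> (if s < k then 1 else 0)"
    proof -
      have "length (filter ((<) s) (ps' @ qs')) = size (filter_mset ((<) s) (mset ps' + mset qs'))"
        by (metis mset_append mset_filter size_mset)
      then show ?thesis using *(4) s_less_r k by (auto split: if_splits)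
    qed
    then have "length (filter ((<) s) ((ps' @ ps) @ (qs' @ qs))) \<le> length (filter ((<) s) (k # ks))"
      using ij(3) by (auto split: if_splits)
    ultimately show ?thesis by blast
  qed
qed

lemma first_descendants_bounded_words:
  assumes "w \<in> word b ` bounded_words r s M"
  shows "first_descendants w \<subseteq> word b ` bounded_words r s M"
proof -
  from assms obtain ks where w: "w = word b ks" and ks: "ks \<in> bounded_words r s M" by blast
  then obtain ps qs where
    split: "w = pair (word b ps) (word b qs) \<or> w = pair (word b ps) (word b qs) \<otimes>\<^bsub>W\<^esub> \<sigma>" and
    set: "set (ps @ qs) \<subseteq> {1..r}" and
    count: "\<forall>j\<in>{1..s}. count_list (ps @ qs) j \<le> count_list ks (Suc j)" and
    large: "length (filter ((<) s) (ps @ qs)) \<le> length (filter ((<) s) ks)"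
    using word_decomposition[of ks] by (auto simp: bounded_words_def)
  have ks_large: "length (filter ((<) s) ks) \<le> M"
    using ks by (simp add: bounded_words_def)
  have "count_list (ps @ qs) j \<le> M" if j: "j \<in> {1..s}" for j
  proof -
    \<comment> \<open>For \<open>j = s\<close> the index \<open>Suc j\<close> has no bound of its
      own, and the joint bound takes over.\<close>
    have "count_list ks (Suc j) \<le> M"
    proof (cases "j = s")
      case True
      then show ?thesis
        using count_list_le_length_filter[of "(<) s" "Suc j" ks] ks_large by simp
    next
      case False
      then show ?thesis using ks j by (simp add: bounded_words_def)
    qed
    then show ?thesis using count j by (meson le_trans)
  qed
  then have "ps @ qs \<in> bounded_words r s M" "ps \<in> bounded_words r s M" "qs \<in> bounded_words r s M"
    using set large ks_large unfolding bounded_words_def by (auto dest!: add_leE)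
  moreover have "first_descendants w \<subseteq> {word b ps, word b qs, word b (ps @ qs)}"
    using split first_descendants_pair[of "word b ps" "word b qs"]
      first_descendants_pair_swap[of "word b ps" "word b qs"] word_in_W[of ps] word_in_W[of qs] set
    by (auto simp: word_append mult_W)
  ultimately show ?thesis by blast
qed

lemma nth_descendants_bounded_words:
  assumes "w \<in> word b ` bounded_words r s M"
  shows "nth_descendants n w \<subseteq> word b ` bounded_words r s M"
proof (induction n)
  case 0
  show ?case using assms by simp
next
  case (Suc n)
  then show ?case using first_descendants_bounded_words by fastforce
qed

lemma Phi_finite_Gamma:
  assumes "w \<in> Gamma r b"
  shows "Phi_finite w"
proof -
  obtain ps where ps: "set ps \<subseteq> {1..r}" "w = word b ps"
    using Gamma_subset_words[OF assms] by blast
  \<comment> \<open>The length of \<open>ps\<close> bounds every letter count, so it can serve as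
    \<open>M\<close>.\<close>
  then have "w \<in> word b ` bounded_words r s (length ps)"
    by (auto simp: bounded_words_def count_le_length)
  then have "Desc w \<subseteq> word b ` bounded_words r s (length ps)"
    unfolding Desc_def using nth_descendants_bounded_words by blast
  then show ?thesis
    unfolding Phi_finite_def using finite_bounded_words by (meson finite_imageI finite_subset)
qed

end

theorem proposition5p11:
  fixes r s :: nat and x :: "nat \<Rightarrow> bool" and b :: "nat \<Rightarrow> vertex \<Rightarrow> vertex"
    and w :: "vertex \<Rightarrow> vertex"
  assumes "r > s" and "s > 0"
    and "\<forall>i\<in>{1..r}. b i \<in> carrier W"
    and "recursion_relations r s x b"
    and "w \<in> Gamma r b"
  shows "Phi_finite w"
proof -
  interpret recursive_generators r s x b
    using assms by unfold_locales auto
  show ?thesis using assms(5) by (rule Phi_finite_Gamma)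
qed

end
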